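(* Let $L$ be a domain, let $E$ be a metrizable topological space with Borel $\sigma$-algebra $\mathcal{B}$, open subsets $\mathcal{G}$ and closed subsets $\mathcal{F}$. Then every $L$-valued optimal measure $\nu$ on $\mathcal{B}$ satisfies $$\nu(B) = \bigwedge_{G\in\mathcal{G}, G\supset B}\nu(G) = \bigoplus_{F\in\mathcal{F}, F\subset B}\nu(F)$$ for all $B\in\mathcal{B}$.
   Context: $\bigoplus$ denotes supremum, $\bigwedge$ infimum; the equations assert that these exist with the stated values. A filter in a poset $L$ is a nonempty upper set $F$ in which any two elements have a lower bound in $F$. $s\gg r$ means: for every filter $F$ having an infimum, $r\geqslant\bigwedge F$ implies $s\in F$. $L$ is continuous if for every $r\in L$ the set $\{s: s\gg r\}$ is a filter with infimum $r$. A domain is a continuous poset in which every filter has an infimum; every domain is assumed to have a bottom element $0$. A map $\nu:\mathcal{B}\to L$ is a $\sigma$-maxitive measure if $\nu(\emptyset)=0$ and for every countable family $(B_j)$ in $\mathcal{B}$, the supremum of the $\nu(B_j)$ exists and equals $\nu(\bigcup_j B_j)$. It is continuous from above if $\nu(\bigcap_n B_n)=\bigwedge_n\nu(B_n)$ for every nonincreasing sequence $B_1\supset B_2\supset\cdots$ in $\mathcal{B}$. An optimal measure is a continuous from above $\sigma$-maxitive measure. (On a metrizable space $\mathcal{B}$ is the usual Borel $\sigma$-algebra.) *)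

theory Defs
  imports "HOL-Analysis.Analysis" "HOL-Library.Lub_Glb"
begin

definition poset_filter :: "'b::order set \<Rightarrow> bool" where
  "poset_filter F \<longleftrightarrow>
     F \<noteq> {} \<and>
     (\<forall>x\<in>F. \<forall>y. x \<le> y \<longrightarrow> y \<in> F) \<and>
     (\<forall>x\<in>F. \<forall>y\<in>F. \<exists>z\<in>F. z \<le> x \<and> z \<le> y)"

definition way_above :: "'b::order \<Rightarrow> 'b \<Rightarrow> bool" where
  "way_above s r \<longleftrightarrow>
     (\<forall>F i. poset_filter F \<longrightarrow> isGlb UNIV F i \<longrightarrow> i \<le> r \<longrightarrow> s \<in> F)"

text \<open>The poset is the universe of a type; the argument of type
  \<open>'b itself\<close> only conveys that type. The bottom element of a domain is supplied by the class
  \<^class>\<open>order_bot\<close>.\<close>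

definition continuous_poset :: "'b::order itself \<Rightarrow> bool" where
  "continuous_poset _ \<longleftrightarrow>
     (\<forall>r :: 'b. poset_filter {s. way_above s r} \<and> isGlb UNIV {s. way_above s r} r)"

definition poset_domain :: "'b::order_bot itself \<Rightarrow> bool" where
  "poset_domain L \<longleftrightarrow>
     continuous_poset L \<and>
     (\<forall>F :: 'b set. poset_filter F \<longrightarrow> (\<exists>i. isGlb UNIV F i))"

text \<open>The values of \<open>\<nu>\<close> outside the set system \<open>M\<close> are irrelevant. A family is represented by
  the set of its members, since both its union and the supremum of its values depend only on that
  set; finite and empty families are included.\<close>

definition sigma_maxitive_measure :: "'a set set \<Rightarrow> ('a set \<Rightarrow> 'b::order_bot) \<Rightarrow> bool" where
  "sigma_maxitive_measure M \<nu> \<longleftrightarrow>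
     \<nu> {} = bot \<and>
     (\<forall>\<C>. countable \<C> \<longrightarrow> \<C> \<subseteq> M \<longrightarrow> isLub UNIV (\<nu> ` \<C>) (\<nu> (\<Union>\<C>)))"

definition continuous_from_above :: "'a set set \<Rightarrow> ('a set \<Rightarrow> 'b::order) \<Rightarrow> bool" where
  "continuous_from_above M \<nu> \<longleftrightarrow>
     (\<forall>B :: nat \<Rightarrow> 'a set. range B \<subseteq> M \<longrightarrow> decseq B \<longrightarrow>
        isGlb UNIV (range (\<lambda>n. \<nu> (B n))) (\<nu> (\<Inter>n. B n)))"

definition optimal_measure :: "'a set set \<Rightarrow> ('a set \<Rightarrow> 'b::order_bot) \<Rightarrow> bool" where
  "optimal_measure M \<nu> \<longleftrightarrow> sigma_maxitive_measure M \<nu> \<and> continuous_from_above M \<nu>"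

definition borel_sets_of :: "'a topology \<Rightarrow> 'a set set" where
  "borel_sets_of X = sigma_sets (topspace X) {U. openin X U}"

end

(* The key fact: for every s way above 0, every Borel set A lies between a closed F and an open G
   with \<nu>(G - F) \<le> s. Sets with this property form a sigma-algebra (for a countable union of
   sandwiches F_n, G_n, the tails of the union of the F_n decrease to the empty set, so finitely many
   F_n suffice), and closed sets have it because they are G-deltas and \<nu> is continuous at the empty
   set. Both formulas follow, since \<nu>(G) is the supremum of \<nu>(A) and \<nu>(G - A), and \<nu>(A) that of \<nu>(F)
   and \<nu>(A - F): an s way above \<nu>(A), respectively above a bound of all \<nu>(F), absorbs the remainder.
   Maxitivity keeps the same s throughout, so no interpolation of the way-above relation is needed. *)
theory Submission
  imports Defs
begin

section \<open>Infima, suprema and the way-above relation\<close>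

lemma isGlb_imageI:
  assumes "\<And>x. x \<in> S \<Longrightarrow> i \<le> f x" "\<And>l. (\<And>x. x \<in> S \<Longrightarrow> l \<le> f x) \<Longrightarrow> l \<le> i"
  shows "isGlb UNIV (f ` S) i"
  unfolding isGlb_def greatestP_def isLb_def setge_def setle_def using assms by auto

lemma isLub_imageI:
  assumes "\<And>x. x \<in> S \<Longrightarrow> f x \<le> u" "\<And>v. (\<And>x. x \<in> S \<Longrightarrow> f x \<le> v) \<Longrightarrow> u \<le> v"
  shows "isLub UNIV (f ` S) u"
  unfolding isLub_def leastP_def isUb_def setge_def setle_def using assms by auto

text \<open>The principal filter \<open>{r..}\<close> has infimum \<open>r\<close>, so it contains
  every \<open>s\<close> way above \<open>r\<close>.\<close>

lemma way_above_imp_ge: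
  assumes "way_above s r"
  shows "r \<le> s"
proof -
  have "poset_filter {r..}"
    by (auto simp: poset_filter_def)
  moreover have "isGlb UNIV {r..} r"
    by (auto simp: isGlb_def greatestP_def isLb_def setge_def setle_def)
  ultimately show ?thesis
    using assms by (auto simp: way_above_def)
qed

lemma way_above_mono:
  "way_above s r \<Longrightarrow> r' \<le> r \<Longrightarrow> way_above s r'"
  unfolding way_above_def by (meson order_trans)

text \<open>The upward closure of a decreasing sequence is a filter with the same lower bounds as
  the sequence, hence with the same infimum; membership of \<open>s\<close> in it says that some
  term is below \<open>s\<close>.\<close>

lemma way_above_decseq:
  fixes f :: "nat \<Rightarrow> 'b::order"
  assumes "decseq f" "isGlb UNIV (range f) i" "way_above s i"
  obtains n where "f n \<le> s"
proof -
  let ?F = "{x. \<exists>n. f n \<le> x}"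
  have "\<exists>z\<in>?F. z \<le> x \<and> z \<le> y" if "f m \<le> x" "f n \<le> y" for x y m n
    using that decseqD[OF assms(1), of m "max m n"] decseqD[OF assms(1), of n "max m n"]
    by (intro bexI[of _ "f (max m n)"]) auto
  then have "poset_filter ?F"
    unfolding poset_filter_def by (blast intro: order.trans)
  moreover have "isLb UNIV ?F = isLb UNIV (range f)"
    unfolding fun_eq_iff isLb_def setge_def by (blast intro: order.refl order.trans)
  then have "isGlb UNIV ?F i"
    using assms(2) by (simp add: isGlb_def)
  ultimately have "s \<in> ?F"
    using assms(3) by (auto simp: way_above_def)
  then show ?thesis
    using that by auto
qed

text \<open>Replaces the usual epsilon argument: in a continuous poset \<open>r\<close> is the
  infimum of the elements way above it.\<close>

lemma le_if_below_way_above: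
  fixes r :: "'b::order"
  assumes "continuous_poset TYPE('b)" "\<And>s. way_above s r \<Longrightarrow> l \<le> s"
  shows "l \<le> r"
proof -
  have "isGlb UNIV {s. way_above s r} r"
    using assms(1) by (auto simp: continuous_poset_def)
  then show ?thesis
    using assms(2) unfolding isGlb_def greatestP_def isLb_def setge_def setle_def by blast
qed

section \<open>Maxitive and optimal measures\<close>

lemma sigma_maxitive_isLub:
  assumes "sigma_maxitive_measure M \<nu>" "countable \<C>" "\<C> \<subseteq> M"
  shows "isLub UNIV (\<nu> ` \<C>) (\<nu> (\<Union>\<C>))"
  using assms(1)[unfolded sigma_maxitive_measure_def, THEN conjunct2, rule_format, OF assms(2,3)] .

lemma sigma_maxitive_mono:
  assumes "sigma_maxitive_measure M \<nu>" "A \<in> M" "B \<in> M" "A \<subseteq> B"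
  shows "\<nu> A \<le> \<nu> B"
proof -
  have "isLub UNIV (\<nu> ` {A, B}) (\<nu> (\<Union>{A, B}))"
    by (rule sigma_maxitive_isLub[OF assms(1)]) (use assms(2,3) in auto)
  moreover have "\<Union>{A, B} = B"
    using assms(4) by auto
  ultimately have "isLub UNIV {\<nu> A, \<nu> B} (\<nu> B)"
    by simp
  then show ?thesis
    by (rule isLubD2) simp
qed

lemma sigma_maxitive_Union_le:
  assumes "sigma_maxitive_measure M \<nu>" "countable \<C>" "\<C> \<subseteq> M" "\<And>A. A \<in> \<C> \<Longrightarrow> \<nu> A \<le> s"
  shows "\<nu> (\<Union>\<C>) \<le> s"
proof (rule isLub_le_isUb[OF sigma_maxitive_isLub[OF assms(1-3)]])
  show "isUb UNIV (\<nu> ` \<C>) s"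
    unfolding isUb_def setle_def using assms(4) by blast
qed

lemma sigma_maxitive_subset_Un_le:
  assumes "sigma_maxitive_measure M \<nu>" "A \<in> M" "B \<in> M" "A \<union> B \<in> M" "C \<in> M"
    and "C \<subseteq> A \<union> B" "\<nu> A \<le> s" "\<nu> B \<le> s"
  shows "\<nu> C \<le> s"
proof -
  have "\<nu> C \<le> \<nu> (A \<union> B)"
    using assms(1,5,4,6) by (rule sigma_maxitive_mono)
  also have "\<nu> (\<Union>{A, B}) \<le> s"
    by (rule sigma_maxitive_Union_le[OF assms(1)]) (use assms(2,3,7,8) in auto)
  then have "\<nu> (A \<union> B) \<le> s"
    by simp
  finally show ?thesis .
qed

text \<open>Continuity from above makes \<open>\<nu> {} = bot\<close> the infimum of the decreasing
  values \<open>\<nu> (A n)\<close>, and an element way above that infimum dominates some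
  term.\<close>

lemma optimal_measure_decseq_empty:
  assumes "optimal_measure M \<nu>" "range A \<subseteq> M" "decseq A" "(\<Inter>n. A n) = {}" "way_above s bot"
  obtains n :: nat where "\<nu> (A n) \<le> s"
proof -
  have \<nu>: "sigma_maxitive_measure M \<nu>" "continuous_from_above M \<nu>"
    using assms(1) by (auto simp: optimal_measure_def)
  have "decseq (\<lambda>n. \<nu> (A n))"
    using assms(2,3) by (auto simp: decseq_def intro!: sigma_maxitive_mono[OF \<nu>(1)])
  moreover have "isGlb UNIV (range (\<lambda>n. \<nu> (A n))) (\<nu> (\<Inter>n. A n))"
    using assms(2,3) \<nu>(2) unfolding continuous_from_above_def by blast
  then have "isGlb UNIV (range (\<lambda>n. \<nu> (A n))) bot"
    using assms(4) \<nu>(1) by (simp add: sigma_maxitive_measure_def)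
  ultimately show ?thesis
    using way_above_decseq[OF _ _ assms(5)] that by blast
qed

section \<open>Approximation between closed and open sets\<close>

definition sandwiched :: "'a topology \<Rightarrow> ('a set \<Rightarrow> 'b::order) \<Rightarrow> 'b \<Rightarrow> 'a set \<Rightarrow> bool" where
  "sandwiched X \<nu> s A \<longleftrightarrow>
     (\<exists>F G. closedin X F \<and> openin X G \<and> F \<subseteq> A \<and> A \<subseteq> G \<and> \<nu> (G - F) \<le> s)"

lemma sigma_algebra_borel_sets_of: "sigma_algebra (topspace X) (borel_sets_of X)"
  unfolding borel_sets_of_def
  by (rule sigma_algebra_sigma_sets) (auto dest: openin_subset)

lemma openin_borel_sets_of: "openin X U \<Longrightarrow> U \<in> borel_sets_of X"
  unfolding borel_sets_of_def by auto

lemma closedin_borel_sets_of: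
  assumes "closedin X F"
  shows "F \<in> borel_sets_of X"
proof -
  interpret sigma_algebra "topspace X" "borel_sets_of X"
    by (rule sigma_algebra_borel_sets_of)
  have "topspace X - (topspace X - F) \<in> borel_sets_of X"
    using assms by (intro compl_sets openin_borel_sets_of) (auto simp: closedin_def)
  then show ?thesis
    using closedin_subset[OF assms] by (simp add: double_diff)
qed

text \<open>Complements of \<open>G\<close> and \<open>F\<close> become the inner closed and the
  outer open set; the gap stays the same set \<open>G - F\<close>.\<close>

lemma sandwiched_Compl:
  assumes "sandwiched X \<nu> s A" "A \<subseteq> topspace X"
  shows "sandwiched X \<nu> s (topspace X - A)"
proof -
  obtain F G where FG: "closedin X F" "openin X G" "F \<subseteq> A" "A \<subseteq> G" "\<nu> (G - F) \<le> s"
    using assms(1) by (auto simp: sandwiched_def)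
  have "(topspace X - F) - (topspace X - G) = G - F"
    using openin_subset[OF FG(2)] by auto
  then show ?thesis
    unfolding sandwiched_def using FG
    by (intro exI[of _ "topspace X - G"] exI[of _ "topspace X - F"]) auto
qed

text \<open>Metrizability enters here: it makes \<open>F\<close> the intersection of decreasing open
  sets \<open>G n\<close>. The gaps \<open>G n - F\<close> shrink to the empty set, so
  \<open>F\<close> itself and a late \<open>G n\<close> serve.\<close>

lemma closedin_sandwiched:
  assumes "metrizable_space X" "optimal_measure (borel_sets_of X) \<nu>" "way_above s bot"
    and "closedin X F"
  shows "sandwiched X \<nu> s F"
proof -
  interpret sigma_algebra "topspace X" "borel_sets_of X"
    by (rule sigma_algebra_borel_sets_of)
  obtain G where G: "\<And>n::nat. openin X (G n)" "\<And>n. G (Suc n) \<subseteq> G n" "(\<Inter>n. G n) = F"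
    using closed_imp_gdelta_in[OF assms(1,4)] unfolding gdelta_in_descending by blast
  have "decseq G"
    using G(2) by (rule decseq_SucI)
  then have "decseq (\<lambda>n. G n - F)"
    by (force simp: decseq_def)
  moreover have "range (\<lambda>n. G n - F) \<subseteq> borel_sets_of X"
    using G(1) assms(4) by (auto intro: openin_borel_sets_of closedin_borel_sets_of)
  moreover have "(\<Inter>n. G n - F) = {}"
    using G(3) by auto
  ultimately obtain n where "\<nu> (G n - F) \<le> s"
    using optimal_measure_decseq_empty[OF assms(2) _ _ _ assms(3)] by blast
  then show ?thesis
    unfolding sandwiched_def using G assms(4) by (intro exI[of _ F] exI[of _ "G n"]) auto
qed

lemma sandwiched_UN:
  fixes A :: "nat \<Rightarrow> 'a set"
  assumes "optimal_measure (borel_sets_of X) \<nu>" "way_above s bot" "\<And>n. sandwiched X \<nu> s (A n)"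
  shows "sandwiched X \<nu> s (\<Union>n. A n)"
proof -
  interpret sigma_algebra "topspace X" "borel_sets_of X"
    by (rule sigma_algebra_borel_sets_of)
  have \<nu>: "sigma_maxitive_measure (borel_sets_of X) \<nu>"
    using assms(1) by (auto simp: optimal_measure_def)
  obtain F G where FG: "\<And>n. closedin X (F n)" "\<And>n. openin X (G n)" "\<And>n. F n \<subseteq> A n"
    "\<And>n. A n \<subseteq> G n" "\<And>n. \<nu> (G n - F n) \<le> s"
    using assms(3) unfolding sandwiched_def by metis
  have F: "F n \<in> borel_sets_of X" and G: "G n \<in> borel_sets_of X" for n
    using FG(1,2) by (auto intro: openin_borel_sets_of closedin_borel_sets_of)
  \<comment> \<open>An infinite union of the closed sets \<open>F k\<close> need not be closed, so
    only finitely many are kept; \<open>?R n\<close> is what this truncation loses.\<close>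
  let ?R = "\<lambda>n. (\<Union>k. F k) - (\<Union>k\<le>n. F k)"
  have UF: "(\<Union>k\<le>n. F k) \<in> borel_sets_of X" for n
    using F by auto
  have "decseq ?R"
    by (rule decseq_SucI) (auto simp: atMost_Suc)
  moreover have R: "?R n \<in> borel_sets_of X" for n
    using F UF by (intro Diff countable_UN) auto
  moreover have "(\<Inter>n. ?R n) = {}"
    by auto
  ultimately obtain n where n: "\<nu> (?R n) \<le> s"
    using optimal_measure_decseq_empty[OF assms(1) _ _ _ assms(2), of ?R] by blast
  \<comment> \<open>The union of the individual gaps. By maxitivity it is bounded by the same
    \<open>s\<close> as each gap, so errors do not add up.\<close>
  let ?D = "\<Union>k. G k - F k"
  have D: "?D \<in> borel_sets_of X"
    using F G by (intro countable_UN) auto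
  have D_le: "\<nu> ?D \<le> s"
    using F G FG(5) by (intro sigma_maxitive_Union_le[OF \<nu>]) auto
  \<comment> \<open>A point of \<open>G k\<close> outside the first \<open>F\<close> sets lies in
    \<open>G k - F k\<close>, hence in \<open>?D\<close>, or in \<open>F k\<close>, hence in
    \<open>?R n\<close>.\<close>
  have "\<nu> ((\<Union>k. G k) - (\<Union>k\<le>n. F k)) \<le> s"
  proof (rule sigma_maxitive_subset_Un_le[OF \<nu> D R[of n]])
    show "?D \<union> ?R n \<in> borel_sets_of X"
      by (rule Un[OF D R])
    show "(\<Union>k. G k) - (\<Union>k\<le>n. F k) \<in> borel_sets_of X"
      using G by (intro Diff UF countable_UN) auto
  qed (use n D_le in auto)
  moreover have "closedin X (\<Union>k\<le>n. F k)"
    using FG(1) by (intro closedin_Union) auto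
  moreover have "openin X (\<Union>k. G k)"
    using FG(2) by auto
  moreover have "(\<Union>k\<le>n. F k) \<subseteq> (\<Union>k. A k)" "(\<Union>k. A k) \<subseteq> (\<Union>k. G k)"
    using FG(3,4) by blast+
  ultimately show ?thesis
    unfolding sandwiched_def by blast
qed

lemma borel_sandwiched:
  assumes "metrizable_space X" "optimal_measure (borel_sets_of X) \<nu>" "way_above s bot"
    and "A \<in> borel_sets_of X"
  shows "sandwiched X \<nu> s A"
  using assms(4) unfolding borel_sets_of_def
proof (induction rule: sigma_sets.induct)
  case (Basic U)
  then have "openin X U"
    by simp
  \<comment> \<open>The generators are open while the approximation is known for closed sets, so it
    is passed through the complement.\<close>
  then have "sandwiched X \<nu> s (topspace X - U)"
    by (intro closedin_sandwiched[OF assms(1-3)]) auto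
  from sandwiched_Compl[OF this] show ?case
    using openin_subset[OF \<open>openin X U\<close>] by (simp add: double_diff)
next
  case Empty
  show ?case
    by (rule closedin_sandwiched[OF assms(1-3)]) simp
next
  case (Compl A)
  then have "A \<subseteq> topspace X"
    by (auto dest: sigma_sets_into_sp[rotated] openin_subset)
  then show ?case
    using Compl by (intro sandwiched_Compl)
next
  case (Union A)
  then show ?case
    by (intro sandwiched_UN[OF assms(2,3)])
qed

theorem proposition4p3:
  fixes E :: "'a topology"
    and \<nu> :: "'a set \<Rightarrow> 'b::order_bot"
    and B :: "'a set"
  assumes "poset_domain TYPE('b)"
    and "metrizable_space E"
    and "optimal_measure (borel_sets_of E) \<nu>"
    and "B \<in> borel_sets_of E"
  shows "isGlb UNIV (\<nu> ` {G. openin E G \<and> B \<subseteq> G}) (\<nu> B) \<and>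
         isLub UNIV (\<nu> ` {F. closedin E F \<and> F \<subseteq> B}) (\<nu> B)"
proof
  interpret sigma_algebra "topspace E" "borel_sets_of E"
    by (rule sigma_algebra_borel_sets_of)
  have cont: "continuous_poset TYPE('b)"
    using assms(1) by (simp add: poset_domain_def)
  have \<nu>: "sigma_maxitive_measure (borel_sets_of E) \<nu>"
    using assms(3) by (simp add: optimal_measure_def)
  note borel = openin_borel_sets_of closedin_borel_sets_of
  \<comment> \<open>Anything way above some \<open>r\<close> is way above \<open>bot\<close>, so the
    approximation of \<open>B\<close> is available at every such \<open>s\<close>.\<close>
  have sandwich: "\<exists>F G. closedin E F \<and> openin E G \<and> F \<subseteq> B \<and> B \<subseteq> G \<and> \<nu> (G - F) \<le> s"
    if "way_above s r" for s r
    using borel_sandwiched[OF assms(2,3) way_above_mono[OF that bot_least] assms(4)]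
    unfolding sandwiched_def .
  have "l \<le> \<nu> B" if l: "\<And>G. openin E G \<Longrightarrow> B \<subseteq> G \<Longrightarrow> l \<le> \<nu> G" for l
  proof (rule le_if_below_way_above[OF cont])
    fix s assume s: "way_above s (\<nu> B)"
    then obtain F G where FG: "closedin E F" "openin E G" "F \<subseteq> B" "B \<subseteq> G" "\<nu> (G - F) \<le> s"
      using sandwich[OF s] by blast
    have "F \<in> borel_sets_of E" "G \<in> borel_sets_of E"
      using FG(1,2) by (simp_all add: borel)
    \<comment> \<open>Since \<open>F \<subseteq> B\<close>, the open set \<open>G\<close> exceeds
      \<open>B\<close> only within the gap \<open>G - F\<close>.\<close>
    then have "B \<in> borel_sets_of E" "G - F \<in> borel_sets_of E" "B \<union> (G - F) \<in> borel_sets_of E"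
      "G \<in> borel_sets_of E" "G \<subseteq> B \<union> (G - F)"
      using FG(3) assms(4) by auto
    from sigma_maxitive_subset_Un_le[OF \<nu> this way_above_imp_ge[OF s] FG(5)]
    show "l \<le> s"
      by (rule order.trans[OF l[OF FG(2,4)]])
  qed
  moreover have "\<nu> B \<le> \<nu> G" if "openin E G" "B \<subseteq> G" for G
    using sigma_maxitive_mono[OF \<nu> assms(4) borel(1)[OF that(1)] that(2)] .
  ultimately show "isGlb UNIV (\<nu> ` {G. openin E G \<and> B \<subseteq> G}) (\<nu> B)"
    by (intro isGlb_imageI) simp_all
  have "\<nu> B \<le> u" if u: "\<And>F. closedin E F \<Longrightarrow> F \<subseteq> B \<Longrightarrow> \<nu> F \<le> u" for u
  proof (rule le_if_below_way_above[OF cont])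
    \<comment> \<open>Here \<open>s\<close> is way above \<open>u\<close>, not
      \<open>\<nu> B\<close>: the part of \<open>B\<close> outside the gap lies in \<open>F\<close>,
      where \<open>\<nu> F \<le> u \<le> s\<close>.\<close>
    fix s assume s: "way_above s u"
    then obtain F G where FG: "closedin E F" "openin E G" "F \<subseteq> B" "B \<subseteq> G" "\<nu> (G - F) \<le> s"
      using sandwich[OF s] by blast
    have "F \<in> borel_sets_of E" "G \<in> borel_sets_of E"
      using FG(1,2) by (simp_all add: borel)
    then have "F \<in> borel_sets_of E" "G - F \<in> borel_sets_of E" "F \<union> (G - F) \<in> borel_sets_of E"
      "B \<in> borel_sets_of E" "B \<subseteq> F \<union> (G - F)"
      using FG(4) assms(4) by auto
    from sigma_maxitive_subset_Un_le[OF \<nu> this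
        order.trans[OF u[OF FG(1,3)] way_above_imp_ge[OF s]] FG(5)]
    show "\<nu> B \<le> s" .
  qed
  moreover have "\<nu> F \<le> \<nu> B" if "closedin E F" "F \<subseteq> B" for F
    using sigma_maxitive_mono[OF \<nu> borel(2)[OF that(1)] assms(4) that(2)] .
  ultimately show "isLub UNIV (\<nu> ` {F. closedin E F \<and> F \<subseteq> B}) (\<nu> B)"
    by (intro isLub_imageI) simp_all
qed

end
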